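(* There exist infinitely many (pairwise non-isomorphic) planar graphs $G$ with $\chi_1(G) = 3$.
   Context: All graphs are finite and simple. A mapping $f : V(G) \to E(G) \cup \{\emptyset\}$ is a $1$-selection of $G$ if for every $v \in V(G)$ either $f(v)$ is an edge incident with $v$ or $f(v) = \emptyset$. The graph $G_f$ is obtained from $G$ by deleting all edges in $f(V(G))$. The robust chromatic number is $\chi_1(G) = \min_f \chi(G_f)$, the minimum over all $1$-selections $f$ of $G$ of the chromatic number of $G_f$. *)

theory Defs
  imports "HOL-Analysis.Analysis"
begin

definition simple_graph :: "'a set \<Rightarrow> 'a set set \<Rightarrow> bool" where
  "simple_graph V E \<longleftrightarrow> finite V \<and> (\<forall>e\<in>E. e \<subseteq> V \<and> card e = 2)"

definition graph_iso :: "'a set \<Rightarrow> 'a set set \<Rightarrow> 'b set \<Rightarrow> 'b set set \<Rightarrow> bool" where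
  "graph_iso V E V' E' \<longleftrightarrow>
     (\<exists>h. bij_betw h V V' \<and> (\<forall>x\<in>V. \<forall>y\<in>V. {x, y} \<in> E \<longleftrightarrow> {h x, h y} \<in> E'))"

definition planar :: "'a set \<Rightarrow> 'a set set \<Rightarrow> bool" where
  "planar V E \<longleftrightarrow>
     (\<exists>(p :: 'a \<Rightarrow> complex) (\<gamma> :: 'a set \<Rightarrow> real \<Rightarrow> complex).
        inj_on p V \<and>
        (\<forall>e\<in>E. arc (\<gamma> e) \<and> {pathstart (\<gamma> e), pathfinish (\<gamma> e)} = p ` e \<and>
                 path_image (\<gamma> e) \<inter> p ` V = p ` e) \<and>
        (\<forall>e\<in>E. \<forall>e'\<in>E. e \<noteq> e' \<longrightarrow>
                 path_image (\<gamma> e) \<inter> path_image (\<gamma> e') \<subseteq> p ` (e \<inter> e')))"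

definition proper_coloring :: "'a set \<Rightarrow> 'a set set \<Rightarrow> ('a \<Rightarrow> nat) \<Rightarrow> nat \<Rightarrow> bool" where
  "proper_coloring V E c k \<longleftrightarrow>
     (\<forall>v\<in>V. c v < k) \<and> (\<forall>x\<in>V. \<forall>y\<in>V. {x, y} \<in> E \<longrightarrow> c x \<noteq> c y)"

definition chromatic_number :: "'a set \<Rightarrow> 'a set set \<Rightarrow> nat" where
  "chromatic_number V E = (LEAST k. \<exists>c. proper_coloring V E c k)"

text \<open>A 1-selection: each vertex selects an incident edge or nothing;
  "nothing" (the empty set symbol of the paper) is represented by the empty set,
  which is never an edge.\<close>
definition one_selection :: "'a set \<Rightarrow> 'a set set \<Rightarrow> ('a \<Rightarrow> 'a set) \<Rightarrow> bool" where
  "one_selection V E f \<longleftrightarrow> (\<forall>v\<in>V. (f v \<in> E \<and> v \<in> f v) \<or> f v = {})"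

definition selection_delete :: "'a set \<Rightarrow> 'a set set \<Rightarrow> ('a \<Rightarrow> 'a set) \<Rightarrow> 'a set set" where
  "selection_delete V E f = E - f ` V"

definition robust_chromatic_number :: "'a set \<Rightarrow> 'a set set \<Rightarrow> nat" where
  "robust_chromatic_number V E =
     (LEAST k. \<exists>f. one_selection V E f \<and> chromatic_number V (selection_delete V E f) = k)"

end

theory Submission
  imports Defs
begin

text \<open>
  A graph has robust chromatic number at most 2 iff its vertices can be 2-coloured so that every
  monochromatic edge can be assigned to one of its ends with no vertex used twice. The dual of
  Tutte's fragment is a triangulated triangle for which this fails whenever the corners 1 and 2
  agree and the corner 0 differs, unless a corner gives its own selection to an inner edge of the
  fragment. Putting fragments, suitably rotated, into nine of the ten faces of a stacked
  triangulation on seven vertices asks too much of these seven vertices: in every 2-colouring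
  they cannot serve all monochromatic edges of the triangulation and all violated fragments.
  Adding isolated vertices to the resulting planar graph on 70 vertices yields infinitely many
  examples.
\<close>

section \<open>Straight-line drawings\<close>

text \<open>Straight segments serve as the arcs. They are written as convex hulls because an edge is
  an unordered pair, so neither end has to be singled out as the start.\<close>

lemma planar_straight_line:
  fixes q :: "'a \<Rightarrow> complex"
  assumes "simple_graph V E" and inj: "inj_on q V"
    and vert: "\<And>e. e \<in> E \<Longrightarrow> convex hull (q ` e) \<inter> q ` V \<subseteq> q ` e"
    and edge: "\<And>e e'. e \<in> E \<Longrightarrow> e' \<in> E \<Longrightarrow> e \<noteq> e' \<Longrightarrow>
        convex hull (q ` e) \<inter> convex hull (q ` e') \<subseteq> q ` (e \<inter> e')"
  shows "planar V E"
proof -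
  have "\<exists>g. arc g \<and> {pathstart g, pathfinish g} = q ` e \<and> path_image g = convex hull (q ` e)"
    if "e \<in> E" for e
  proof -
    from that assms(1) obtain a b where e: "e = {a, b}" "a \<noteq> b" "a \<in> V" "b \<in> V"
      unfolding simple_graph_def by (metis card_2_iff insert_subset)
    then have "q a \<noteq> q b"
      using inj by (auto dest: inj_onD)
    then show ?thesis
      using e by (intro exI[of _ "linepath (q a) (q b)"]) (simp add: segment_convex_hull)
  qed
  then obtain g where g: "\<And>e. e \<in> E \<Longrightarrow> arc (g e) \<and>
      {pathstart (g e), pathfinish (g e)} = q ` e \<and> path_image (g e) = convex hull (q ` e)"
    by metis
  have "path_image (g e) \<inter> q ` V = q ` e" if "e \<in> E" for e
  proof
    show "path_image (g e) \<inter> q ` V \<subseteq> q ` e"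
      using vert[OF that] g[OF that] by simp
    show "q ` e \<subseteq> path_image (g e) \<inter> q ` V"
      using g[OF that] that assms(1) hull_subset[of "q ` e" convex]
      by (auto simp: simple_graph_def)
  qed
  then show ?thesis
    unfolding planar_def using inj g edge by (intro exI[of _ q] exI[of _ g]) simp
qed

section \<open>Integer tests for the intersection of segments\<close>

type_synonym point = "int \<times> int"

text \<open>Twice the signed area of the triangle \<open>a\<close>, \<open>b\<close>,
  \<open>c\<close>; its sign tells on which side of the line through \<open>a\<close> and
  \<open>b\<close> the point \<open>c\<close> lies.\<close>

definition cross :: "point \<Rightarrow> point \<Rightarrow> point \<Rightarrow> int" where
  "cross a b c = (fst b - fst a) * (snd c - snd a) - (snd b - snd a) * (fst c - fst a)"

text \<open>A sufficient test for two segments to meet in common end points only. The bounding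
  boxes are compared first to keep the evaluation on the whole drawing cheap.\<close>

fun separated :: "point \<times> point \<Rightarrow> point \<times> point \<Rightarrow> bool" where
  "separated (a, b) (c, d) =
    (if max (fst a) (fst b) < min (fst c) (fst d) then True
     else if max (fst c) (fst d) < min (fst a) (fst b) then True
     else if max (snd a) (snd b) < min (snd c) (snd d) then True
     else if max (snd c) (snd d) < min (snd a) (snd b) then True
     else if a = c \<or> b = c then cross a b d \<noteq> 0
     else if a = d \<or> b = d then cross a b c \<noteq> 0
     else if 0 < cross a b c * cross a b d then True
     else 0 < cross c d a * cross c d b)"

definition pt :: "point \<Rightarrow> complex" where
  "pt a = Complex (of_int (fst a)) (of_int (snd a))"

text \<open>Extends \<open>cross a b\<close> to an affine function on the plane, since a point
  common to two segments need not be integral.\<close>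

definition crossR :: "point \<Rightarrow> point \<Rightarrow> complex \<Rightarrow> real" where
  "crossR a b z = of_int (fst b - fst a) * (Im z - of_int (snd a)) -
    of_int (snd b - snd a) * (Re z - of_int (fst a))"

lemma crossR_pt: "crossR a b (pt c) = of_int (cross a b c)"
  by (simp add: crossR_def cross_def pt_def)

lemma crossR_convex:
  "crossR a b ((1 - u) *\<^sub>R x + u *\<^sub>R y) = (1 - u) * crossR a b x + u * crossR a b y"
  by (simp add: crossR_def algebra_simps)

lemma crossR_segment:
  assumes "z \<in> closed_segment (pt a) (pt b)"
  shows "crossR a b z = 0"
proof -
  from assms obtain u where "z = (1 - u) *\<^sub>R pt a + u *\<^sub>R pt b"
    by (auto simp: in_segment)
  moreover have "crossR a b (pt a) = 0" "crossR a b (pt b) = 0"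
    by (simp_all add: crossR_pt cross_def algebra_simps)
  ultimately show ?thesis
    by (simp add: crossR_convex)
qed

text \<open>The affine function \<open>crossR a b\<close> vanishes on the first segment and has the
  same strict sign at both ends of the second, hence on all of it.\<close>

lemma same_side_disjoint:
  assumes "0 < cross a b c * cross a b d"
  shows "closed_segment (pt a) (pt b) \<inter> closed_segment (pt c) (pt d) = {}"
proof -
  have False if z: "z \<in> closed_segment (pt a) (pt b)" "z \<in> closed_segment (pt c) (pt d)" for z
  proof -
    obtain u where u: "0 \<le> u" "u \<le> 1" "z = (1 - u) *\<^sub>R pt c + u *\<^sub>R pt d"
      using z(2) by (auto simp: in_segment)
    define x y :: real where "x = of_int (cross a b c)" and "y = of_int (cross a b d)"
    have *: "(1 - u) * x + u * y = 0"
      using crossR_segment[OF z(1)] u(3) by (simp add: crossR_convex crossR_pt x_def y_def)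
    have "0 < x * y"
      using assms unfolding x_def y_def by (metis of_int_0_less_iff of_int_mult)
    then consider "0 < x" "0 < y" | "x < 0" "y < 0"
      by (auto simp: zero_less_mult_iff)
    then show False
    proof cases
      case 1
      then show False
        using * u(1,2) by (smt (verit) mult_nonneg_nonneg mult_pos_pos)
    next
      case 2
      then show False
        using * u(1,2) by (smt (verit) mult_nonneg_nonpos mult_pos_neg)
    qed
  qed
  then show ?thesis
    by blast
qed

text \<open>Along the segment from \<open>c\<close> to \<open>d\<close> the affine function
  \<open>crossR a b\<close> starts at 0 and ends at a nonzero value, so it vanishes at
  \<open>c\<close> only.\<close>

lemma common_end_point:
  assumes "cross a b d \<noteq> 0" and "c = a \<or> c = b"
  shows "closed_segment (pt a) (pt b) \<inter> closed_segment (pt c) (pt d) \<subseteq> {pt c}"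
proof
  fix z assume z: "z \<in> closed_segment (pt a) (pt b) \<inter> closed_segment (pt c) (pt d)"
  then obtain u where u: "z = (1 - u) *\<^sub>R pt c + u *\<^sub>R pt d"
    by (auto simp: in_segment)
  have "crossR a b (pt c) = 0"
    using assms(2) by (auto simp: crossR_pt cross_def algebra_simps)
  then have "u * crossR a b (pt d) = 0"
    using crossR_segment[of z a b] z by (simp add: u crossR_convex)
  then have "u = 0"
    using assms(1) by (simp add: crossR_pt)
  then show "z \<in> {pt c}"
    by (simp add: u)
qed

lemma segment_bounds:
  assumes "z \<in> closed_segment (pt a) (pt b)"
  shows "of_int (min (fst a) (fst b)) \<le> Re z" "Re z \<le> of_int (max (fst a) (fst b))"
    "of_int (min (snd a) (snd b)) \<le> Im z" "Im z \<le> of_int (max (snd a) (snd b))"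
proof -
  have "closed_segment (pt a) (pt b) \<subseteq>
      {z. of_int (min (fst a) (fst b)) \<le> Re z} \<inter> {z. Re z \<le> of_int (max (fst a) (fst b))} \<inter>
      {z. of_int (min (snd a) (snd b)) \<le> Im z} \<inter> {z. Im z \<le> of_int (max (snd a) (snd b))}"
    unfolding segment_convex_hull
    by (rule hull_minimal)
      (auto simp: pt_def intro!: convex_Int convex_halfspace_Re_ge convex_halfspace_Re_le
        convex_halfspace_Im_ge convex_halfspace_Im_le)
  then show "of_int (min (fst a) (fst b)) \<le> Re z" "Re z \<le> of_int (max (fst a) (fst b))"
    "of_int (min (snd a) (snd b)) \<le> Im z" "Im z \<le> of_int (max (snd a) (snd b))"
    using assms by blast+
qed

lemma separated_segments:
  assumes "separated (a, b) (c, d)"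
  shows "closed_segment (pt a) (pt b) \<inter> closed_segment (pt c) (pt d) \<subseteq> pt ` ({a, b} \<inter> {c, d})"
proof -
  let ?ab = "closed_segment (pt a) (pt b)" and ?cd = "closed_segment (pt c) (pt d)"
  have box: "?ab \<inter> ?cd = {}"
    if "max (fst a) (fst b) < min (fst c) (fst d) \<or> max (fst c) (fst d) < min (fst a) (fst b) \<or>
        max (snd a) (snd b) < min (snd c) (snd d) \<or> max (snd c) (snd d) < min (snd a) (snd b)"
  proof -
    have False if "z \<in> ?ab" "z \<in> ?cd" for z
      using segment_bounds[OF that(1)] segment_bounds[OF that(2)]
        \<open>max (fst a) (fst b) < _ \<or> _\<close> by linarith
    then show ?thesis
      by blast
  qed
  consider
    "max (fst a) (fst b) < min (fst c) (fst d) \<or> max (fst c) (fst d) < min (fst a) (fst b) \<or>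
      max (snd a) (snd b) < min (snd c) (snd d) \<or> max (snd c) (snd d) < min (snd a) (snd b)"
    | "c = a \<or> c = b" "cross a b d \<noteq> 0"
    | "d = a \<or> d = b" "cross a b c \<noteq> 0"
    | "0 < cross a b c * cross a b d"
    | "0 < cross c d a * cross c d b"
    using assms unfolding separated.simps by (metis (full_types))
  then show ?thesis
  proof cases
    case 1
    then show ?thesis
      using box by blast
  next
    case 2
    then show ?thesis
      using common_end_point[of a b d c] by auto
  next
    case 3
    then show ?thesis
      using common_end_point[of a b c d] by (auto simp: closed_segment_commute)
  next
    case 4
    then show ?thesis
      using same_side_disjoint by blast
  next
    case 5
    then show ?thesis
      using same_side_disjoint by blast
  qed
qed

section \<open>The graph\<close>

text \<open>Vertex 3 is stacked into the triangle 0, 1, 2, then 4 into 0, 2, 3, then 5 into 0, 1, 3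
  and 6 into 0, 3, 4. The outer face 0, 1, 2 is the one without a fragment.\<close>

definition base_edges :: "(nat \<times> nat) list" where
  "base_edges =
    [(0, 1), (0, 2), (1, 2), (0, 3), (1, 3), (2, 3), (0, 4), (2, 4), (3, 4), (0, 5), (1, 5),
    (3, 5), (0, 6), (3, 6), (4, 6)]"

text \<open>The planar dual of Tutte's fragment: a triangulated triangle with corners 0, 1, 2 and
  seven inner vertices. Only the edges with an inner end vertex are listed.\<close>

definition fragment_edges :: "(nat \<times> nat) list" where
  "fragment_edges =
    [(1, 3), (2, 3), (0, 4), (1, 4), (4, 5), (2, 6), (3, 6), (5, 6), (0, 7), (2, 7), (4, 7),
    (5, 7), (1, 8), (3, 8), (4, 8), (5, 8), (6, 8), (2, 9), (5, 9), (6, 9), (7, 9)]"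

text \<open>The faces of the base that receive a fragment, in the order of the corners 0, 1, 2.\<close>

definition cells :: "nat list list" where
  "cells = [[1, 5, 3], [6, 3, 0], [1, 3, 2], [1, 0, 5], [5, 0, 3], [3, 4, 2], [6, 4, 3], [6, 0, 4],
    [4, 0, 2]]"

text \<open>Corners are shared with the base; the inner vertices of cell \<open>j\<close> form a
  block of seven starting at \<open>7 * (j + 1)\<close>. This gives 7 + 9 * 7 = 70 vertices.\<close>

definition cell_vertex :: "nat \<Rightarrow> nat \<Rightarrow> nat" where
  "cell_vertex j i = (if i < 3 then cells ! j ! i else 7 * j + i + 4)"

definition edge_list :: "(nat \<times> nat) list" where
  "edge_list = base_edges @
    concat (map (\<lambda>j. map (\<lambda>(a, b). (cell_vertex j a, cell_vertex j b)) fragment_edges) [0..<9])"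

definition edges :: "nat set set" where
  "edges = (\<lambda>(a, b). {a, b}) ` set edge_list"

lemma edge_list_vertices:
  assumes "(a, b) \<in> set edge_list"
  shows "a \<noteq> b \<and> a < 70 \<and> b < 70"
proof -
  have "list_all (\<lambda>(a, b). a \<noteq> b \<and> a < 70 \<and> b < 70) edge_list"
    by code_simp
  then show ?thesis
    using assms by (auto simp: list_all_iff)
qed

lemma edgesE:
  assumes "e \<in> edges"
  obtains a b where "(a, b) \<in> set edge_list" "e = {a, b}" "a \<noteq> b" "a < 70" "b < 70"
  using assms edge_list_vertices unfolding edges_def by fastforce

lemma simple_graph_edges:
  assumes "70 \<le> n"
  shows "simple_graph {..<n} edges"
  using assms by (fastforce simp: simple_graph_def elim!: edgesE)

section \<open>Planarity\<close>

definition base_point :: "point list" where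
  "base_point = [(4, 0), (7, 6), (0, 7), (5, 6), (3, 3), (5, 3), (4, 1)]"

text \<open>Barycentric coordinates, multiplied by 9, of the vertices of a straight-line drawing of
  the fragment.\<close>

definition weight :: "(int \<times> int \<times> int) list" where
  "weight =
    [(9, 0, 0), (0, 9, 0), (0, 0, 9), (1, 4, 4), (4, 3, 2), (3, 2, 4), (2, 2, 5), (4, 1, 4),
    (2, 4, 3), (3, 1, 5)]"

fun combine :: "int \<times> int \<times> int \<Rightarrow> point \<Rightarrow> point \<Rightarrow> point \<Rightarrow> point" where
  "combine (k, l, m) (x, y) (x', y') (x'', y'') =
    (k * x + l * x' + m * x'', k * y + l * y' + m * y'')"

text \<open>Scaling by 9 makes all coordinates integral, and the index arithmetic inverts
  \<open>cell_vertex\<close>. Isolated vertices lie to the right of the drawing.\<close>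

definition position :: "nat \<Rightarrow> point" where
  "position v =
    (if v < 7 then (9 * fst (base_point ! v), 9 * snd (base_point ! v))
     else if v < 70 then
       let t = cells ! ((v - 7) div 7) in
       combine (weight ! ((v - 7) mod 7 + 3))
         (base_point ! (t ! 0)) (base_point ! (t ! 1)) (base_point ! (t ! 2))
     else (int v, 0))"

text \<open>An evaluation over all pairs of the 204 edges, each pair being tested in one order
  only.\<close>

lemma drawing_separated:
  "sorted_wrt separated (map (\<lambda>(a, b). (position a, position b)) edge_list)"
  by code_simp

lemma position_bounded: "v < 70 \<Longrightarrow> fst (position v) \<le> 63"
proof -
  have "list_all (\<lambda>v. fst (position v) \<le> 63) [0..<70]"
    by code_simp
  then show "v < 70 \<Longrightarrow> fst (position v) \<le> 63"
    by (simp add: list_all_iff)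
qed

lemma position_isolated: "\<not> v < 70 \<Longrightarrow> position v = (int v, 0)"
  by (simp add: position_def)

lemma inj_position: "inj position"
proof -
  have "distinct (map position [0..<70])"
    by code_simp
  then have *: "inj_on position {..<70}"
    by (simp add: distinct_map atLeast0LessThan)
  have "u = v" if "position u = position v" for u v
  proof (cases "u < 70 \<longleftrightarrow> v < 70")
    case True
    then show ?thesis
      using that inj_onD[OF *] by (cases "u < 70") (auto simp: position_isolated)
  next
    case False
    then show ?thesis
      using that position_bounded[of u] position_bounded[of v]
      by (cases "u < 70") (auto simp: position_isolated prod_eq_iff)
  qed
  then show ?thesis
    by (rule injI)
qed

lemma inj_pt: "inj pt"
  by (auto simp: pt_def intro!: injI prod_eqI)

lemma edge_hulls:
  assumes "e \<in> edges" "e' \<in> edges" "e \<noteq> e'"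
  shows "convex hull ((pt \<circ> position) ` e) \<inter> convex hull ((pt \<circ> position) ` e')
    \<subseteq> (pt \<circ> position) ` (e \<inter> e')"
proof -
  define es where "es = map (\<lambda>(a, b). (position a, position b)) edge_list"
  have less: "convex hull ((pt \<circ> position) ` {a, b}) \<inter> convex hull ((pt \<circ> position) ` {c, d})
      \<subseteq> (pt \<circ> position) ` ({a, b} \<inter> {c, d})"
    if "i < j" "j < length edge_list" "edge_list ! i = (a, b)" "edge_list ! j = (c, d)"
    for i j a b c d
  proof -
    have "separated (es ! i) (es ! j)"
      using drawing_separated that(1,2) unfolding es_def
      by (intro sorted_wrt_nth_less) auto
    then have "separated (position a, position b) (position c, position d)"
      using that by (simp add: es_def)
    from separated_segments[OF this] show ?thesis
      unfolding segment_convex_hull image_comp[symmetric] image_Int[OF inj_position] by simp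
  qed
  from assms obtain a b c d where ab: "(a, b) \<in> set edge_list" "e = {a, b}"
    and cd: "(c, d) \<in> set edge_list" "e' = {c, d}"
    by (auto elim!: edgesE)
  then obtain i j where i: "i < length edge_list" "edge_list ! i = (a, b)"
    and j: "j < length edge_list" "edge_list ! j = (c, d)"
    by (auto simp: in_set_conv_nth)
  have "i \<noteq> j"
    using i j ab cd assms(3) by auto
  then consider "i < j" | "j < i"
    by linarith
  then show ?thesis
  proof cases
    case 1
    then show ?thesis
      using less[OF 1 j(1) i(2) j(2)] ab cd by simp
  next
    case 2
    then show ?thesis
      using less[OF 2 i(1) j(2) i(2)] ab cd by (simp add: Int_commute)
  qed
qed

text \<open>Serves to show that no edge runs through a foreign vertex: a vertex on the segment of
  \<open>e\<close> also lies on an edge of its own, and two edges meet in common ends only.\<close>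

lemma covered_by_edge:
  assumes "v < 70"
  obtains e where "e \<in> edges" "v \<in> e"
proof -
  have "\<exists>a. (a, v) \<in> set edge_list \<or> (v, a) \<in> set edge_list"
  proof (cases "v < 7")
    case True
    then have "v \<in> {0, 1, 2, 3, 4, 5, 6}"
      by auto
    then show ?thesis
      by (auto simp: edge_list_def base_edges_def)
  next
    case False
    define j i where "j = v div 7 - 1" and "i = v mod 7 + 3"
    have "j < 9" "v = 7 * j + i + 4"
      unfolding j_def i_def using assms False by presburger+
    then have v: "j < 9" "v = cell_vertex j i"
      by (simp_all add: cell_vertex_def i_def)
    have "i \<in> {3, 4, 5, 6, 7, 8, 9}"
      unfolding i_def by auto
    then have "\<exists>a. (a, i) \<in> set fragment_edges"
      by (elim insertE emptyE) (simp_all add: fragment_edges_def ex_disj_distrib)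
    then obtain a where "(a, i) \<in> set fragment_edges" ..
    then have "(cell_vertex j a, v) \<in> set edge_list"
      using v unfolding edge_list_def by force
    then show ?thesis
      by blast
  qed
  then obtain a where "(a, v) \<in> set edge_list \<or> (v, a) \<in> set edge_list" ..
  then have "{a, v} \<in> edges"
    by (force simp: edges_def)
  then show ?thesis
    using that by blast
qed

lemma planar_edges:
  assumes "70 \<le> n"
  shows "planar {..<n} edges"
proof (rule planar_straight_line[where q = "pt \<circ> position"])
  show "simple_graph {..<n} edges"
    using assms by (rule simple_graph_edges)
  have inj: "inj (pt \<circ> position)"
    using inj_pt inj_position by (rule inj_compose)
  then show "inj_on (pt \<circ> position) {..<n}"
    by (rule inj_on_subset) simp
  show "convex hull ((pt \<circ> position) ` e) \<inter> (pt \<circ> position) ` {..<n} \<subseteq> (pt \<circ> position) ` e"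
    if e: "e \<in> edges" for e
  proof
    fix z assume z: "z \<in> convex hull ((pt \<circ> position) ` e) \<inter> (pt \<circ> position) ` {..<n}"
    then obtain v where v: "z = (pt \<circ> position) v"
      by blast
    have "v \<in> e"
    proof (cases "v < 70")
      case True
      then obtain e' where e': "e' \<in> edges" "v \<in> e'"
        by (rule covered_by_edge)
      have "z \<in> convex hull ((pt \<circ> position) ` e')"
        using v e' by (auto intro: hull_inc)
      then show ?thesis
        using edge_hulls[OF e e'(1)] z v e'(2) injD[OF inj] by blast
    next
      case False
      have "(pt \<circ> position) ` e \<subseteq> {z. Re z \<le> 63}"
        using e position_bounded by (auto simp: pt_def elim!: edgesE)
      then have "convex hull ((pt \<circ> position) ` e) \<subseteq> {z. Re z \<le> 63}"
        by (intro hull_minimal convex_halfspace_Re_le)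
      then have "Re z \<le> 63"
        using z by blast
      moreover have "Re z = real v"
        using False by (simp add: v pt_def position_isolated)
      ultimately show ?thesis
        using False by simp
    qed
    then show "z \<in> (pt \<circ> position) ` e"
      using v by blast
  qed
qed (rule edge_hulls)

section \<open>Two colours do not suffice\<close>

text \<open>In the following lemmas \<open>s v\<close> is the other end of the edge selected by \<open>v\<close>, so that
  properness after deletion says that every monochromatic edge is selected by one of its ends.\<close>

lemma fragment_not_colorable:
  fixes c :: "nat \<Rightarrow> bool" and s :: "nat \<Rightarrow> nat"
  assumes "c 1 = c 2" "c 0 \<noteq> c 1"
    and sel: "\<And>a b. (a, b) \<in> set fragment_edges \<Longrightarrow> c a = c b \<Longrightarrow> 3 \<le> a \<and> s a = b \<or> s b = a"
  shows False
proof -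
  define t where "t v = int (s v)" for v
  have t: "c a = c b \<Longrightarrow> 3 \<le> a \<and> t a = int b \<or> t b = int a" if "(a, b) \<in> set fragment_edges" for a b
    using sel[OF that] by (auto simp: t_def)
  \<comment> \<open>The inner vertices have finitely many 2-colourings; in each of them some
    monochromatic edges have too few inner ends to select them.\<close>
  show False
    using assms(1,2)
      t[of 1 3] t[of 2 3] t[of 0 4] t[of 1 4] t[of 4 5] t[of 2 6] t[of 3 6] t[of 5 6] t[of 0 7]
      t[of 2 7] t[of 4 7] t[of 5 7] t[of 1 8] t[of 3 8] t[of 4 8] t[of 5 8] t[of 6 8] t[of 2 9]
      t[of 5 9] t[of 6 9] t[of 7 9]
    unfolding fragment_edges_def by (simp del: One_nat_def) (smt (z3))
qed

text \<open>The value \<open>j + 7\<close> encodes a selection spent on cell \<open>j\<close> and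
  cannot clash with the base vertices 0 to 6. What remains is a finite check on seven colours and
  seven selections.\<close>

lemma base_not_colorable:
  fixes c :: "nat \<Rightarrow> bool" and s :: "nat \<Rightarrow> nat"
  assumes base: "\<And>a b. (a, b) \<in> set base_edges \<Longrightarrow> c a = c b \<Longrightarrow> s a = b \<or> s b = a"
    and cell: "\<And>j. j < 9 \<Longrightarrow> c (cells ! j ! 1) = c (cells ! j ! 2) \<Longrightarrow>
      c (cells ! j ! 0) \<noteq> c (cells ! j ! 1) \<Longrightarrow> \<exists>i<3. s (cells ! j ! i) = j + 7"
  shows False
proof -
  define t where "t v = int (s v)" for v
  have b: "c a = c b \<Longrightarrow> t a = int b \<or> t b = int a" if "(a, b) \<in> set base_edges" for a b
    using base[OF that] by (auto simp: t_def)
  have f: "c (cells ! j ! 1) = c (cells ! j ! 2) \<Longrightarrow> c (cells ! j ! 0) \<noteq> c (cells ! j ! 1) \<Longrightarrow>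
      t (cells ! j ! 0) = int j + 7 \<or> t (cells ! j ! 1) = int j + 7 \<or> t (cells ! j ! 2) = int j + 7"
    if "j < 9" for j
    using cell[OF that] by (auto simp: t_def less_Suc_eq numeral_3_eq_3 numeral_2_eq_2)
  show False
    using b[of 0 1] b[of 0 2] b[of 1 2] b[of 0 3] b[of 1 3] b[of 2 3] b[of 0 4] b[of 2 4] b[of 3 4]
      b[of 0 5] b[of 1 5] b[of 3 5] b[of 0 6] b[of 3 6] b[of 4 6]
      f[of 0] f[of 1] f[of 2] f[of 3] f[of 4] f[of 5] f[of 6] f[of 7] f[of 8]
    unfolding base_edges_def cells_def by (simp del: One_nat_def) (smt (z3))
qed

lemma inj_cell_vertex:
  assumes "j < 9"
  shows "inj_on (cell_vertex j) {..<10}"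
proof -
  have "list_all (\<lambda>j. distinct (map (cell_vertex j) [0..<10])) [0..<9]"
    by code_simp
  then show ?thesis
    using assms by (auto simp: list_all_iff distinct_map atLeast0LessThan)
qed

text \<open>By \<open>fragment_not_colorable\<close>, each violated cell uses up the selection of
  one of its corners; then \<open>base_not_colorable\<close> applies.\<close>

lemma not_two_colorable:
  fixes c :: "nat \<Rightarrow> bool" and s :: "nat \<Rightarrow> nat"
  assumes sel: "\<And>a b. (a, b) \<in> set edge_list \<Longrightarrow> c a = c b \<Longrightarrow> s a = b \<or> s b = a"
  shows False
proof -
  text \<open>The target of a selection by a base vertex, where only the cell matters if an inner edge
    of a fragment is selected; the inner vertices of cell \<open>j\<close> are \<open>7 * (j + 1), ..., 7 * (j + 1) + 6\<close>.\<close>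
  define t where "t v = (if s v < 7 then s v else s v div 7 + 6)" for v
  have "\<exists>i<3. t (cells ! j ! i) = j + 7"
    if j: "j < 9" and col: "c (cells ! j ! 1) = c (cells ! j ! 2)" "c (cells ! j ! 0) \<noteq> c (cells ! j ! 1)"
    for j
  proof (rule ccontr)
    assume no: "\<not> ?thesis"
    let ?h = "cell_vertex j"
    \<comment> \<open>The selection in the numbering of the fragment. Where \<open>s\<close> leaves
      the cell, \<open>r\<close> is unspecified, but only selections of edges inside the cell are
      transferred.\<close>
    define r where "r i = inv_into {..<10} ?h (s (?h i))" for i
    have corner: "s (?h a) \<noteq> ?h b" if "a < 3" "3 \<le> b" "b < 10" for a b
    proof
      assume s: "s (?h a) = ?h b"
      have "?h b = 7 * (j + 1) + (b - 3)"
        using that by (simp add: cell_vertex_def)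
      then have "\<not> ?h b < 7" "?h b div 7 = j + 1"
        using that by simp_all
      then have "t (?h a) = j + 7"
        by (simp add: t_def s)
      then show False
        using no that by (auto simp: cell_vertex_def)
    qed
    show False
    proof (rule fragment_not_colorable[of "c \<circ> ?h" r])
      show "(c \<circ> ?h) 1 = (c \<circ> ?h) 2" "(c \<circ> ?h) 0 \<noteq> (c \<circ> ?h) 1"
        using col by (simp_all add: cell_vertex_def)
      fix a b assume ab: "(a, b) \<in> set fragment_edges" and "(c \<circ> ?h) a = (c \<circ> ?h) b"
      have lt: "a < 10" "3 \<le> b" "b < 10"
        using ab by (auto simp: fragment_edges_def)
      have "(?h a, ?h b) \<in> set edge_list"
        using ab j by (force simp: edge_list_def)
      then have "s (?h a) = ?h b \<or> s (?h b) = ?h a"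
        using sel \<open>(c \<circ> ?h) a = (c \<circ> ?h) b\<close> by simp
      then show "3 \<le> a \<and> r a = b \<or> r b = a"
        using lt corner[of a b] inv_into_f_f[OF inj_cell_vertex[OF j]]
        by (auto simp: r_def not_less[symmetric])
    qed
  qed
  moreover have "t a = b \<or> t b = a" if "(a, b) \<in> set base_edges" "c a = c b" for a b
  proof -
    have "a < 7" "b < 7"
      using that(1) by (auto simp: base_edges_def)
    moreover have "s a = b \<or> s b = a"
      using that by (intro sel) (auto simp: edge_list_def)
    ultimately show ?thesis
      by (auto simp: t_def)
  qed
  ultimately show False
    by (intro base_not_colorable[of c t])
qed

lemma selection_not_two_colorable:
  assumes "70 \<le> n" "one_selection {..<n} edges f" "k < 3"
  shows "\<not> proper_coloring {..<n} (selection_delete {..<n} edges f) c k"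
proof
  assume proper: "proper_coloring {..<n} (selection_delete {..<n} edges f) c k"
  \<comment> \<open>Unspecified when \<open>f v\<close> is empty; only the values at selected edges
    are used.\<close>
  define s where "s v = (THE w. f v = {v, w})" for v
  have s: "s v = w" if "f v = {v, w}" for v w
    unfolding s_def using that by (rule the_equality) (auto simp: that doubleton_eq_iff)
  show False
  proof (rule not_two_colorable[of "\<lambda>v. c v = 0" s])
    fix a b assume ab: "(a, b) \<in> set edge_list" and eq: "(c a = 0) = (c b = 0)"
    have lt: "a < n" "b < n"
      using edge_list_vertices[OF ab] assms(1) by auto
    have "c a < 2" "c b < 2"
      using proper lt assms(3) by (force simp: proper_coloring_def)+
    then have "c a = c b"
      using eq by linarith
    then have "{a, b} \<notin> selection_delete {..<n} edges f"
      using proper lt by (auto simp: proper_coloring_def)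
    moreover have edge: "{a, b} \<in> edges"
      using ab by (force simp: edges_def)
    ultimately obtain v where v: "v < n" "f v = {a, b}"
      by (auto simp: selection_delete_def)
    then have "v = a \<or> v = b"
      using assms(2) by (auto simp: one_selection_def)
    then show "s a = b \<or> s b = a"
      using v s[of a b] s[of b a] by (auto simp: insert_commute)
  qed
qed

section \<open>Three colours suffice\<close>

definition color :: "nat list" where
  "color =
    [2, 0, 1, 2, 0, 1, 1, 0, 0, 2, 1, 1, 2, 0, 1, 1, 2, 0, 0, 0, 1, 1, 1, 1, 2, 2, 0, 0, 2,
    2, 0, 0, 0, 1, 2, 1, 1, 2, 0, 0, 0, 1, 1, 1, 1, 0, 0, 2, 2, 2, 0, 2, 0, 0, 1, 1, 2, 0,
    2, 1, 2, 1, 0, 1, 1, 1, 2, 2, 0, 0]"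

text \<open>The neighbour towards which a vertex selects; an entry equal to its own index means that
  nothing is selected.\<close>

definition target :: "nat list" where
  "target =
    [0, 1, 63, 0, 4, 5, 15, 7, 1, 9, 10, 11, 9, 13, 14, 15, 16, 19, 18, 19, 20, 2, 23, 23,
    24, 25, 26, 27, 0, 0, 32, 30, 1, 33, 34, 35, 5, 37, 38, 39, 38, 41, 2, 44, 44, 45, 46,
    47, 48, 3, 4, 51, 52, 50, 54, 55, 0, 57, 60, 59, 60, 59, 4, 63, 65, 65, 66, 67, 68, 69]"

text \<open>An entry of \<open>target\<close> equal to its index yields a singleton, which is not an
  edge and so becomes the empty selection.\<close>

definition selection :: "nat \<Rightarrow> nat set" where
  "selection v = (if v < 70 \<and> {v, target ! v} \<in> edges then {v, target ! v} else {})"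

lemma one_selection_selection: "one_selection V edges selection"
  by (simp add: one_selection_def selection_def)

lemma selection_three_colorable:
  assumes "70 \<le> n"
  shows "\<exists>c. proper_coloring {..<n} (selection_delete {..<n} edges selection) c 3"
proof -
  define c where "c v = (if v < 70 then color ! v else 0)" for v
  have "list_all (\<lambda>v. color ! v < 3) [0..<70]"
    by code_simp
  then have "c v < 3" for v
    by (simp add: c_def list_all_iff)
  moreover have "c x \<noteq> c y" if xy: "{x, y} \<in> selection_delete {..<n} edges selection" for x y
  proof
    assume eq: "c x = c y"
    have "{x, y} \<in> edges"
      using xy by (simp add: selection_delete_def)
    then obtain a b where ab: "(a, b) \<in> set edge_list" "{x, y} = {a, b}" "a < 70" "b < 70"
      by (rule edgesE)
    have "list_all (\<lambda>(a, b). color ! a \<noteq> color ! b \<or> target ! a = b \<or> target ! b = a) edge_list"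
      by code_simp
    moreover have "color ! a = color ! b"
      using ab eq by (auto simp: c_def doubleton_eq_iff)
    ultimately have "target ! a = b \<or> target ! b = a"
      using ab(1) by (auto simp: list_all_iff)
    moreover have "{a, b} \<in> edges"
      using ab(1) by (force simp: edges_def)
    ultimately have "selection a = {a, b} \<or> selection b = {a, b}"
      using ab(3,4) by (auto simp: selection_def insert_commute)
    then have "{a, b} \<in> selection ` {..<n}"
      using ab(3,4) assms by (metis imageI lessThan_iff order_less_le_trans)
    then show False
      using xy ab(2) by (simp add: selection_delete_def)
  qed
  ultimately show ?thesis
    unfolding proper_coloring_def by blast
qed

section \<open>The robust chromatic number and the infinite family\<close>

lemma chromatic_number_selection_ge:
  assumes "70 \<le> n" "one_selection {..<n} edges f"
  shows "3 \<le> chromatic_number {..<n} (selection_delete {..<n} edges f)"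
proof -
  let ?E = "selection_delete {..<n} edges f"
  \<comment> \<open>Some proper colouring must exist for the least number of colours to be
    attained.\<close>
  have "proper_coloring {..<n} ?E id n"
    by (auto simp: proper_coloring_def selection_delete_def elim!: edgesE)
  then have "\<exists>c. proper_coloring {..<n} ?E c (chromatic_number {..<n} ?E)"
    unfolding chromatic_number_def by (intro LeastI[of "\<lambda>k. \<exists>c. proper_coloring {..<n} ?E c k"] exI)
  then show ?thesis
    using selection_not_two_colorable[OF assms] by (meson not_le)
qed

lemma robust_chromatic_number_edges:
  assumes "70 \<le> n"
  shows "robust_chromatic_number {..<n} edges = 3"
  unfolding robust_chromatic_number_def
proof (rule Least_equality)
  have "chromatic_number {..<n} (selection_delete {..<n} edges selection) \<le> 3"
    unfolding chromatic_number_def using selection_three_colorable[OF assms] by (rule Least_le)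
  then show "\<exists>f. one_selection {..<n} edges f \<and> chromatic_number {..<n} (selection_delete {..<n} edges f) = 3"
    using chromatic_number_selection_ge[OF assms one_selection_selection] one_selection_selection
    by (intro exI[of _ selection]) auto
next
  fix k assume "\<exists>f. one_selection {..<n} edges f \<and> chromatic_number {..<n} (selection_delete {..<n} edges f) = k"
  then show "3 \<le> k"
    using chromatic_number_selection_ge[OF assms] by blast
qed

theorem theorem1p3:
  shows "\<exists>(G :: nat \<Rightarrow> nat set \<times> nat set set).
           (\<forall>i. simple_graph (fst (G i)) (snd (G i)) \<and>
                planar (fst (G i)) (snd (G i)) \<and>
                robust_chromatic_number (fst (G i)) (snd (G i)) = 3) \<and>
           (\<forall>i j. i \<noteq> j \<longrightarrow>
                \<not> graph_iso (fst (G i)) (snd (G i)) (fst (G j)) (snd (G j)))"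
\<comment> \<open>The graphs differ only in the number \<open>i\<close> of isolated vertices, so
  comparing vertex counts excludes an isomorphism.\<close>
proof (intro exI[of _ "\<lambda>i. ({..<70 + i}, edges)"] conjI allI impI)
  fix i j :: nat
  assume "i \<noteq> j"
  then show "\<not> graph_iso (fst ({..<70 + i}, edges)) (snd ({..<70 + i}, edges))
      (fst ({..<70 + j}, edges)) (snd ({..<70 + j}, edges))"
    by (auto simp: graph_iso_def dest!: bij_betw_same_card)
qed (simp_all add: simple_graph_edges planar_edges robust_chromatic_number_edges)

end
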